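(* Let $n_1,n_2,n_3 \in \mathbb{Z}_{>0}$ be distinct with $\gcd(n_1,n_2,n_3)=1$, and let $m_1,m_2,m_3\in\mathbb{Z}$ satisfy $$\frac{m_3}{n_3}\le \frac{m_2}{n_2}\le \frac{m_1}{n_1},$$ with at least one inequality strict. Let $S=\langle n_1,n_2,n_3\rangle=\{x_1n_1+x_2n_2+x_3n_3 : x_1,x_2,x_3\in\mathbb{Z}_{\ge 0}\}$, let $\mathsf{Z}_S(n)=\{\vec x\in\mathbb{Z}_{\ge0}^3 : x_1n_1+x_2n_2+x_3n_3=n\}$, and let $\lambda(\vec x)=m_1x_1+m_2x_2+m_3x_3$ for $\vec x\in\mathbb{Z}^3$. Define the multiset $\Lambda[\![n]\!]=\{\!\{\lambda(\vec x):\vec x\in \mathsf{Z}_S(n)\}\!\}$ (each element $\vec x\in\mathsf{Z}_S(n)$ contributing one copy of $\lambda(\vec x)$), and for a set $I$ let $|\Lambda[\![n]\!]\cap I|$ denote the number of elements of $\Lambda[\![n]\!]$ in $I$ counted with multiplicity. Let $$d=\gcd(m_2n_3-m_3n_2,\; m_1n_3-m_3n_1,\; m_1n_2-m_2n_1),$$ and $$F(t)=\frac{2n_1n_2n_3}{m_1n_3-m_3n_1}\begin{cases}0 & t<\frac{m_3}{n_3},\\[2pt] \dfrac{tn_3-m_3}{m_2n_3-m_3n_2} & \frac{m_3}{n_3}\le t<\frac{m_2}{n_2},\\[6pt] \dfrac{m_1-n_1t}{m_1n_2-m_2n_1} & \frac{m_2}{n_2}\le t<\frac{m_1}{n_1},\\[2pt]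 0 & t\ge \frac{m_1}{n_1}\end{cases}$$ (a possibly degenerate triangular probability density; a case whose interval is empty is omitted). Then for all real $\alpha<\beta$ and all $n\in\mathbb{Z}_{>0}$, $$\left|\frac{|\Lambda[\![n]\!]\cap[\alpha n,\beta n]|}{n^2/(2n_1n_2n_3)}-\int_\alpha^\beta F(x)\,dx\right|\le \frac{2n_1n_2n_3}{n}\left[\frac{5d}{n_2}+\frac{2d}{n}+\left(\beta-\alpha+\frac{2d}{n}\right)\left(1+d\max\{n_1,n_3\}\right)\right].$$
   Context: A numerical semigroup generated by $n_1,n_2,n_3$ is the set of nonnegative integer combinations of them; $\mathsf{Z}_S(n)$ is the set of factorizations of $n$. *)

theory Defs
  imports "HOL-Analysis.Analysis" "HOL-Library.Multiset"
begin

definition generated_semigroup :: "int \<Rightarrow> int \<Rightarrow> int \<Rightarrow> int set" where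
  "generated_semigroup n1 n2 n3 =
     {x1 * n1 + x2 * n2 + x3 * n3 | x1 x2 x3. 0 \<le> x1 \<and> 0 \<le> x2 \<and> 0 \<le> x3}"

text \<open>Factorizations refer to the chosen generators, so these are the parameters rather than
  the semigroup as a set.\<close>

definition factorizations :: "int \<Rightarrow> int \<Rightarrow> int \<Rightarrow> int \<Rightarrow> (int \<times> int \<times> int) set" where
  "factorizations n1 n2 n3 n =
     {(x1, x2, x3). 0 \<le> x1 \<and> 0 \<le> x2 \<and> 0 \<le> x3 \<and> x1 * n1 + x2 * n2 + x3 * n3 = n}"

lemma factorizations_nonempty_iff:
  "factorizations n1 n2 n3 n \<noteq> {} \<longleftrightarrow> n \<in> generated_semigroup n1 n2 n3"
  unfolding factorizations_def generated_semigroup_def by blast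

lemma finite_factorizations:
  assumes "0 < n1" "0 < n2" "0 < n3"
  shows "finite (factorizations n1 n2 n3 n)"
proof (rule finite_subset)
  show "factorizations n1 n2 n3 n \<subseteq> {0..n} \<times> {0..n} \<times> {0..n}"
  proof
    fix x assume "x \<in> factorizations n1 n2 n3 n"
    then obtain x1 x2 x3 where x: "x = (x1, x2, x3)" "0 \<le> x1" "0 \<le> x2" "0 \<le> x3"
      and eq: "x1 * n1 + x2 * n2 + x3 * n3 = n"
      unfolding factorizations_def by auto
    have "x1 * 1 \<le> x1 * n1" "x2 * 1 \<le> x2 * n2" "x3 * 1 \<le> x3 * n3"
      using assms x by (intro mult_left_mono; linarith)+
    with x eq show "x \<in> {0..n} \<times> {0..n} \<times> {0..n}"
      by simp
  qed
qed simp

definition weighted_length :: "int \<Rightarrow> int \<Rightarrow> int \<Rightarrow> int \<times> int \<times> int \<Rightarrow> int" where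
  "weighted_length m1 m2 m3 = (\<lambda>(x1, x2, x3). m1 * x1 + m2 * x2 + m3 * x3)"

text \<open>\<open>mset_set\<close> of an infinite set is empty; by \<open>finite_factorizations\<close> this case does not
  arise for positive generators.\<close>

definition length_mset ::
  "int \<Rightarrow> int \<Rightarrow> int \<Rightarrow> int \<Rightarrow> int \<Rightarrow> int \<Rightarrow> int \<Rightarrow> int multiset" where
  "length_mset n1 n2 n3 m1 m2 m3 n =
     image_mset (weighted_length m1 m2 m3) (mset_set (factorizations n1 n2 n3 n))"

definition mset_count_in :: "int multiset \<Rightarrow> real set \<Rightarrow> nat" where
  "mset_count_in M I = size (filter_mset (\<lambda>v. real_of_int v \<in> I) M)"

definition length_gcd :: "int \<Rightarrow> int \<Rightarrow> int \<Rightarrow> int \<Rightarrow> int \<Rightarrow> int \<Rightarrow> int" where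
  "length_gcd n1 n2 n3 m1 m2 m3 =
     gcd (m2 * n3 - m3 * n2) (gcd (m1 * n3 - m3 * n1) (m1 * n2 - m2 * n1))"

text \<open>For \<open>m3 / n3 \<le> m2 / n2 \<le> m1 / n1\<close>, a branch whose denominator vanishes has an empty
  interval and is never reached.\<close>

definition length_density ::
  "int \<Rightarrow> int \<Rightarrow> int \<Rightarrow> int \<Rightarrow> int \<Rightarrow> int \<Rightarrow> real \<Rightarrow> real" where
  "length_density n1 n2 n3 m1 m2 m3 t =
     real_of_int (2 * n1 * n2 * n3) / real_of_int (m1 * n3 - m3 * n1) *
     (if t < real_of_int m3 / real_of_int n3 then 0
      else if t < real_of_int m2 / real_of_int n2
        then (t * real_of_int n3 - real_of_int m3) / real_of_int (m2 * n3 - m3 * n2)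
      else if t < real_of_int m1 / real_of_int n1
        then (real_of_int m1 - real_of_int n1 * t) / real_of_int (m1 * n2 - m2 * n1)
      else 0)"

end

(* The integer points of the plane x1 n1 + x2 n2 + x3 n3 = n are y + j u + k v, where v is the
   primitive normal to both n and m and where u raises the length by d.  For fixed j one walks along
   a line, on which the nonnegative points form a segment; its length in units of v is n / b times
   a tent function of l / n with peak 1 / n2 at m2 / n2, so the number of factorizations of
   length l = l0 + j d is given by this up to an error of at most 1.  Summing over j compares
   a Riemann sum of a unimodal function with its integral, which costs at most three times the peak. *)

theory Submission
  imports Defs
begin

section \<open>Sums and counts over integers against integrals and lengths\<close>

text \<open>Induction on a bound for \<open>b - a\<close>, removing the last unit interval. It
  contributes one summand and one integral, both between \<open>f (b - 1)\<close> and
  \<open>f b\<close>, so the error grows by at most \<open>f b - f (b - 1)\<close> and the bound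
  telescopes. On an interval shorter than 1 the sum and the integral both lie between 0 and
  \<open>f b\<close>.\<close>

lemma sum_integers_integral_mono_on:
  fixes f :: "real \<Rightarrow> real"
  assumes "a \<le> b" "mono_on {a..b} f" "0 \<le> f a"
  shows "\<bar>(\<Sum>k\<in>{\<lceil>a\<rceil>..\<lfloor>b\<rfloor>}. f (of_int k)) - integral {a..b} f\<bar> \<le> f b"
proof -
  have "\<lbrakk>a \<le> b; b - a < real N; mono_on {a..b} f\<rbrakk> \<Longrightarrow> ?thesis" for N
  proof (induction N arbitrary: b)
    case 0
    then show ?case by simp
  next
    case (Suc N)
    note mono = mono_onD[OF Suc.prems(3)]
    have intf: "f integrable_on {x..b}" if "a \<le> x" for x
      using that by (intro integrable_on_mono_on mono_on_subset[OF Suc.prems(3)]) auto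
    have bounds: "(b - x) * f x \<le> integral {x..b} f" "integral {x..b} f \<le> (b - x) * f b"
      if "a \<le> x" "x \<le> b" for x
    proof -
      have "integral {x..b} (\<lambda>_. f x) \<le> integral {x..b} f"
        using that by (intro integral_le intf mono) auto
      then show "(b - x) * f x \<le> integral {x..b} f"
        using that by simp
      have "integral {x..b} f \<le> integral {x..b} (\<lambda>_. f b)"
        using that by (intro integral_le intf mono) auto
      then show "integral {x..b} f \<le> (b - x) * f b"
        using that by simp
    qed
    have fb: "f a \<le> f b" "0 \<le> f b"
      using mono[of a b] Suc.prems(1) assms(3) by auto
    have sub: "{\<lceil>x\<rceil>..\<lfloor>b\<rfloor>} \<subseteq> {\<lfloor>b\<rfloor>}" if "b - x < 1" for x
      using that by (auto; linarith)
    show ?case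
    proof (cases "b - a < 1")
      case True
      have sum: "0 \<le> (\<Sum>k\<in>{\<lceil>a\<rceil>..\<lfloor>b\<rfloor>}. f (of_int k)) \<and>
          (\<Sum>k\<in>{\<lceil>a\<rceil>..\<lfloor>b\<rfloor>}. f (of_int k)) \<le> f b"
      proof (cases "{\<lceil>a\<rceil>..\<lfloor>b\<rfloor>} = {}")
        case False
        then have eq: "{\<lceil>a\<rceil>..\<lfloor>b\<rfloor>} = {\<lfloor>b\<rfloor>}"
          using sub[OF True] by auto
        then have "a \<le> of_int \<lfloor>b\<rfloor>"
          by (metis atLeastAtMost_iff ceiling_le_iff singletonI)
        then show ?thesis
          using mono[of a "of_int \<lfloor>b\<rfloor>"] mono[of "of_int \<lfloor>b\<rfloor>" b] assms(3) Suc.prems(1)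
          unfolding eq by auto
      qed (use fb in simp)
      have "(b - a) * f b \<le> 1 * f b" "0 \<le> (b - a) * f a"
        using True fb Suc.prems(1) assms(3) by (intro mult_right_mono mult_nonneg_nonneg; linarith)+
      then show ?thesis
        using sum bounds[of a] Suc.prems(1) by auto
    next
      case False
      let ?S = "\<lambda>y. \<Sum>k\<in>{\<lceil>a\<rceil>..\<lfloor>y\<rfloor>}. f (of_int k)"
      have IH: "\<bar>?S (b - 1) - integral {a..b - 1} f\<bar> \<le> f (b - 1)"
        using False Suc.prems
        by (intro Suc.IH mono_on_subset[OF Suc.prems(3)]) auto
      \<comment> \<open>\<open>\<lfloor>b\<rfloor>\<close> is the only integer that is greater than
        \<open>b - 1\<close> and at most \<open>b\<close>; it belongs to the index set because
        \<open>a \<le> b - 1\<close>.\<close>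
      have "{\<lceil>a\<rceil>..\<lfloor>b\<rfloor>} = insert \<lfloor>b\<rfloor> {\<lceil>a\<rceil>..\<lfloor>b - 1\<rfloor>}"
        using False by (auto; linarith)
      then have S: "?S b = f (of_int \<lfloor>b\<rfloor>) + ?S (b - 1)"
        by simp
      have I: "integral {a..b} f = integral {a..b - 1} f + integral {b - 1..b} f"
        using False by (intro Henstock_Kurzweil_Integration.integral_combine[symmetric] intf) auto
      have "f (b - 1) \<le> f (of_int \<lfloor>b\<rfloor>)" "f (of_int \<lfloor>b\<rfloor>) \<le> f b"
        using False by (intro mono; simp; linarith)+
      then show ?thesis
        using IH bounds[of "b - 1"] False unfolding S I by auto
    qed
  qed
  then show ?thesis
    using assms reals_Archimedean2 by blast
qed

text \<open>Reflection in 0 reduces this to the monotone case; negation exchanges floors and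
  ceilings, so the sum is merely reindexed.\<close>

lemma sum_integers_integral_antimono_on:
  fixes f :: "real \<Rightarrow> real"
  assumes "a \<le> b" "antimono_on {a..b} f" "0 \<le> f b"
  shows "\<bar>(\<Sum>k\<in>{\<lceil>a\<rceil>..\<lfloor>b\<rfloor>}. f (of_int k)) - integral {a..b} f\<bar> \<le> f a"
proof -
  have "mono_on {- b..- a} (\<lambda>x. f (- x))"
    using assms(2) by (auto simp: monotone_on_def)
  from sum_integers_integral_mono_on[OF _ this] assms
  have "\<bar>(\<Sum>k\<in>{\<lceil>- b\<rceil>..\<lfloor>- a\<rfloor>}. f (- of_int k)) - integral {a..b} f\<bar> \<le> f a"
    by simp
  moreover have "(\<Sum>k\<in>{\<lceil>- b\<rceil>..\<lfloor>- a\<rfloor>}. f (- of_int k)) = (\<Sum>k\<in>{\<lceil>a\<rceil>..\<lfloor>b\<rfloor>}. f (of_int k))"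
    by (rule sum.reindex_bij_witness[of _ uminus uminus])
       (auto simp: ceiling_minus floor_minus)
  ultimately show ?thesis by simp
qed

lemma integrable_on_antimono_on:
  fixes f :: "real \<Rightarrow> real"
  assumes "antimono_on {a..b} f"
  shows "f integrable_on {a..b}"
proof -
  have "mono_on {a..b} (\<lambda>x. - f x)"
    using assms by (auto simp: monotone_on_def)
  then show ?thesis
    using integrable_on_mono_on integrable_neg_iff by blast
qed

text \<open>Cut the interval at the mode \<open>p\<close>. Each side costs \<open>f p\<close>, and
  the third \<open>f p\<close> pays for the summand at \<open>p\<close>, which both sides contain
  when \<open>p\<close> is an integer.\<close>

lemma sum_integers_integral_unimodal:
  fixes f :: "real \<Rightarrow> real"
  assumes "a \<le> b" "mono_on {..p} f" "antimono_on {p..} f" and nonneg: "\<And>x. 0 \<le> f x"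
  shows "\<bar>(\<Sum>k\<in>{\<lceil>a\<rceil>..\<lfloor>b\<rfloor>}. f (of_int k)) - integral {a..b} f\<bar> \<le> 3 * f p"
    and "f integrable_on {a..b}"
proof -
  let ?S = "\<lambda>x y. \<Sum>k\<in>{\<lceil>x\<rceil>..\<lfloor>y\<rfloor>}. f (of_int k)"
  have left: "\<bar>?S x y - integral {x..y} f\<bar> \<le> f p" "f integrable_on {x..y}"
    if "x \<le> y" "y \<le> p" for x y
  proof -
    have mono: "mono_on {x..y} f"
      using that by (intro mono_on_subset[OF assms(2)]) auto
    have "f y \<le> f p"
      using that assms(2) by (auto intro: mono_onD)
    then show "\<bar>?S x y - integral {x..y} f\<bar> \<le> f p"
      using sum_integers_integral_mono_on[OF that(1) mono nonneg] by linarith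
    show "f integrable_on {x..y}"
      using mono by (rule integrable_on_mono_on)
  qed
  have right: "\<bar>?S x y - integral {x..y} f\<bar> \<le> f p" "f integrable_on {x..y}"
    if "x \<le> y" "p \<le> x" for x y
  proof -
    have anti: "antimono_on {x..y} f"
      using that by (intro monotone_on_subset[OF assms(3)]) auto
    have "f x \<le> f p"
      using that assms(3) by (auto simp: monotone_on_def)
    then show "\<bar>?S x y - integral {x..y} f\<bar> \<le> f p"
      using sum_integers_integral_antimono_on[OF that(1) anti nonneg] by linarith
    show "f integrable_on {x..y}"
      using anti by (rule integrable_on_antimono_on)
  qed
  have "\<bar>?S a b - integral {a..b} f\<bar> \<le> 3 * f p \<and> f integrable_on {a..b}"
  proof (cases "p \<le> a \<or> b \<le> p")
    case True
    then show ?thesis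
      using left[of a b] right[of a b] assms(1) nonneg[of p] by linarith
  next
    case False
    then have ab: "a \<le> p" "p \<le> b" by auto
    have int: "f integrable_on {a..b}"
      using ab left(2) right(2) by (blast intro: Henstock_Kurzweil_Integration.integrable_combine)
    have I: "integral {a..p} f + integral {p..b} f = integral {a..b} f"
      using ab int by (rule Henstock_Kurzweil_Integration.integral_combine)
    have un: "{\<lceil>a\<rceil>..\<lfloor>p\<rfloor>} \<union> {\<lceil>p\<rceil>..\<lfloor>b\<rfloor>} = {\<lceil>a\<rceil>..\<lfloor>b\<rfloor>}"
      using ab by (auto; linarith)
    \<comment> \<open>The overlap is a single point or empty, according to whether \<open>p\<close>
      is an integer. Its sum is bounded by the one-sided estimate on the interval from
      \<open>p\<close> to \<open>p\<close>, whose integral vanishes.\<close>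
    have inter: "{\<lceil>a\<rceil>..\<lfloor>p\<rfloor>} \<inter> {\<lceil>p\<rceil>..\<lfloor>b\<rfloor>} = {\<lceil>p\<rceil>..\<lfloor>p\<rfloor>}"
      using ab by (auto; linarith)
    have "?S a b + ?S p p = ?S a p + ?S p b"
      using sum.union_inter[of "{\<lceil>a\<rceil>..\<lfloor>p\<rfloor>}" "{\<lceil>p\<rceil>..\<lfloor>b\<rfloor>}" "\<lambda>k. f (of_int k)"]
      unfolding un inter by simp
    moreover have "\<bar>?S p p\<bar> \<le> f p"
      using left(1)[of p p] by simp
    ultimately show ?thesis
      using left(1)[of a p] right(1)[of p b] ab int I by linarith
  qed
  then show "\<bar>?S a b - integral {a..b} f\<bar> \<le> 3 * f p" "f integrable_on {a..b}"
    by auto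
qed

text \<open>If \<open>u \<le> v\<close>, rounding the two ends inwards loses less than 1 each, while
  counting both ends adds 1. If \<open>v < u\<close>, the set is empty, which is why the length is
  cut off at 0.\<close>

lemma card_integers_between:
  fixes u v :: real
  shows "\<bar>real (card {k::int. u \<le> of_int k \<and> of_int k \<le> v}) - max 0 (v - u)\<bar> \<le> 1"
proof -
  have "{k::int. u \<le> of_int k \<and> of_int k \<le> v} = {\<lceil>u\<rceil>..\<lfloor>v\<rfloor>}"
    by (auto simp: ceiling_le_iff le_floor_iff)
  then have "card {k::int. u \<le> of_int k \<and> of_int k \<le> v} = nat (\<lfloor>v\<rfloor> - \<lceil>u\<rceil> + 1)"
    by simp
  then show ?thesis by (simp split: split_max; linarith)
qed

section \<open>The reduced minors and the tent function\<close>

text \<open>The minors of the matrix with rows n and m, divided by their gcd \<open>d\<close>, are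
  \<open>a\<close>, \<open>b\<close>, \<open>c\<close>. Their signs express the order of the ratios
  \<open>m3 / n3\<close>, \<open>m2 / n2\<close>, \<open>m1 / n1\<close>, with \<open>0 < b\<close>
  for the strict inequality between the outer two; \<open>a = 0\<close> or \<open>c = 0\<close> is
  the degenerate triangle. The direction v of the overview is \<open>(a, -b, c)\<close>.\<close>

locale embedding =
  fixes n1 n2 n3 m1 m2 m3 a b c d :: int
  assumes n_pos: "0 < n1" "0 < n2" "0 < n3"
    and n_coprime: "gcd n1 (gcd n2 n3) = 1"
    and minors: "m2 * n3 - m3 * n2 = d * a" "m1 * n3 - m3 * n1 = d * b" "m1 * n2 - m2 * n1 = d * c"
    and minor_signs: "0 \<le> a" "0 < b" "0 \<le> c" "0 < d"
    and minors_coprime: "gcd a (gcd b c) = 1"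
begin

text \<open>Up to sign, \<open>d\<close> times \<open>(a, -b, c)\<close> is the cross product of the
  rows n and m, hence orthogonal to both; the factor \<open>d\<close> cancels. The next lemma is the
  same for m.\<close>

lemma orthogonal_n: "a * n1 + c * n3 = b * n2"
proof -
  have "d * (a * n1 + c * n3) = (d * a) * n1 + (d * c) * n3" by algebra
  also have "\<dots> = (d * b) * n2" unfolding minors[symmetric] by algebra
  finally show ?thesis using minor_signs(4) by simp
qed

lemma orthogonal_m: "a * m1 + c * m3 = b * m2"
proof -
  have "d * (a * m1 + c * m3) = (d * a) * m1 + (d * c) * m3" by algebra
  also have "\<dots> = (d * b) * m2" unfolding minors[symmetric] by algebra
  finally show ?thesis using minor_signs(4) by simp
qed

definition fiber :: "int \<Rightarrow> int \<Rightarrow> (int \<times> int \<times> int) set" where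
  "fiber n l = {x \<in> factorizations n1 n2 n3 n. weighted_length m1 m2 m3 x = l}"

text \<open>If \<open>a = 0\<close> (or \<open>c = 0\<close>), the corresponding branch takes the value \<open>x / 0 = 0\<close>,
  so the tent jumps at its peak.\<close>

definition tent :: "real \<Rightarrow> real" where
  "tent t = (if t * of_int n2 < of_int m2 then max 0 ((t * of_int n3 - of_int m3) / (of_int d * of_int a))
             else if t * of_int n2 = of_int m2 then 1 / of_int n2
             else max 0 ((of_int m1 - of_int n1 * t) / (of_int d * of_int c)))"

lemma real_minors:
  "real_of_int m2 * of_int n3 - of_int m3 * of_int n2 = of_int d * of_int a"
  "real_of_int m1 * of_int n3 - of_int m3 * of_int n1 = of_int d * of_int b"
  "real_of_int m1 * of_int n2 - of_int m2 * of_int n1 = of_int d * of_int c"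
  using minors by (metis of_int_mult of_int_diff)+

text \<open>For \<open>0 < a\<close> the left branch extends to the peak: at
  \<open>t = m2 / n2\<close> its numerator is \<open>d * a / n2\<close>, so its value is
  \<open>1 / n2\<close>. This lets one formula serve on the closed half-line;
  \<open>tent_right\<close> is its mirror image.\<close>

lemma tent_left:
  assumes "t * of_int n2 \<le> of_int m2" "0 < a"
  shows "tent t = max 0 ((t * of_int n3 - of_int m3) / (of_int d * of_int a))"
proof (cases "t * of_int n2 = of_int m2")
  case True
  have "(t * of_int n3 - of_int m3) * of_int n2 = of_int d * real_of_int a"
    using True real_minors(1) by (simp add: algebra_simps flip: True)
  then have "(t * of_int n3 - of_int m3) / (of_int d * real_of_int a) = 1 / of_int n2"
    using assms(2) minor_signs n_pos by (simp add: field_simps)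
  then show ?thesis
    using True n_pos by (simp add: tent_def)
qed (use assms in \<open>auto simp: tent_def\<close>)

lemma tent_right:
  assumes "of_int m2 \<le> t * of_int n2" "0 < c"
  shows "tent t = max 0 ((of_int m1 - of_int n1 * t) / (of_int d * of_int c))"
proof (cases "t * of_int n2 = of_int m2")
  case True
  have "(of_int m1 - of_int n1 * t) * of_int n2 = of_int d * real_of_int c"
    using True real_minors(3) by (simp add: algebra_simps flip: True)
  then have "(of_int m1 - of_int n1 * t) / (of_int d * real_of_int c) = 1 / of_int n2"
    using assms(2) minor_signs n_pos by (simp add: field_simps)
  then show ?thesis
    using True n_pos by (simp add: tent_def)
qed (use assms in \<open>auto simp: tent_def\<close>)

lemma tent_nonneg: "0 \<le> tent t"
  using n_pos by (simp add: tent_def)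

lemma tent_peak: "tent (of_int m2 / of_int n2) = 1 / of_int n2"
  using n_pos by (simp add: tent_def)

text \<open>For \<open>a = 0\<close> the tent is 0 before its peak. For \<open>0 < a\<close> it is
  the positive part of an increasing affine function, up to and including the peak.\<close>

lemma mono_on_tent: "mono_on {..of_int m2 / of_int n2} tent"
proof (rule mono_onI)
  fix s t :: real
  assume st: "s \<in> {..of_int m2 / of_int n2}" "t \<in> {..of_int m2 / of_int n2}" "s \<le> t"
  then have le: "s * of_int n2 \<le> of_int m2" "t * of_int n2 \<le> of_int m2"
    using n_pos by (auto simp: field_simps)
  show "tent s \<le> tent t"
  proof (cases "a = 0")
    case True
    consider "s = of_int m2 / of_int n2" | "s * of_int n2 < of_int m2"
      using le(1) n_pos by (fastforce simp: field_simps)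
    then show ?thesis
    proof cases
      case 1
      then show ?thesis using st by simp
    next
      case 2
      then have "tent s = 0" unfolding tent_def by (simp add: True)
      then show ?thesis using tent_nonneg by simp
    qed
  next
    case False
    then have "0 < a" using minor_signs by simp
    then show ?thesis
      using st n_pos minor_signs unfolding tent_left[OF le(1) \<open>0 < a\<close>] tent_left[OF le(2) \<open>0 < a\<close>]
      by (intro max.mono divide_right_mono diff_right_mono mult_right_mono) auto
  qed
qed

lemma antimono_on_tent: "antimono_on {of_int m2 / of_int n2..} tent"
proof (rule monotone_onI)
  fix s t :: real
  assume st: "s \<in> {of_int m2 / of_int n2..}" "t \<in> {of_int m2 / of_int n2..}" "s \<le> t"
  then have le: "of_int m2 \<le> s * of_int n2" "of_int m2 \<le> t * of_int n2"
    using n_pos by (auto simp: field_simps)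
  show "tent t \<le> tent s"
  proof (cases "c = 0")
    case True
    consider "t = of_int m2 / of_int n2" | "of_int m2 < t * of_int n2"
      using le(2) n_pos by (fastforce simp: field_simps)
    then show ?thesis
    proof cases
      case 1
      then show ?thesis using st by simp
    next
      case 2
      then have "tent t = 0" unfolding tent_def by (simp add: True)
      then show ?thesis using tent_nonneg by simp
    qed
  next
    case False
    then have "0 < c" using minor_signs by simp
    then show ?thesis
      using st n_pos minor_signs unfolding tent_right[OF le(1) \<open>0 < c\<close>] tent_right[OF le(2) \<open>0 < c\<close>]
      by (intro max.mono divide_right_mono diff_left_mono mult_left_mono) auto
  qed
qed

text \<open>Unimodality gives integrability even when \<open>a = 0\<close> or \<open>c = 0\<close>
  makes the tent discontinuous.\<close>

lemma integrable_tent: "\<alpha> \<le> \<beta> \<Longrightarrow> tent integrable_on {\<alpha>..\<beta>}"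
  using sum_integers_integral_unimodal(2) mono_on_tent antimono_on_tent tent_nonneg by blast

section \<open>Integer points of the plane and their lengths\<close>

text \<open>Eliminating \<open>x3\<close>, \<open>x1\<close> and \<open>x2\<close> in turn from the
  two equations leaves the minors as coefficients. The first two relations give the length of the
  segment of nonnegative points, the third tells on which side of the peak \<open>l / n\<close>
  lies.\<close>

lemma linear_relations:
  assumes "x1 * n1 + x2 * n2 + x3 * n3 = n" "m1 * x1 + m2 * x2 + m3 * x3 = l"
  shows "d * (a * x2 + b * x1) = n3 * l - m3 * n"
    and "d * (b * x3 + c * x2) = m1 * n - n1 * l"
    and "d * (c * x1 - a * x3) = n2 * l - m2 * n"
  using minors unfolding assms[symmetric] by algebra+

text \<open>The relations with right-hand side 0 say that the vector is parallel to
  \<open>(a, -b, c)\<close>, and this direction is primitive because \<open>a\<close>,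
  \<open>b\<close>, \<open>c\<close> are coprime.\<close>

lemma kernel_multiple:
  assumes "x1 * n1 + x2 * n2 + x3 * n3 = 0" "m1 * x1 + m2 * x2 + m3 * x3 = 0"
  obtains k where "x1 = k * a" "x2 = - k * b" "x3 = k * c"
proof -
  obtain p q' where "p * a + q' * gcd b c = 1"
    using bezout_int[of a "gcd b c"] minors_coprime by auto
  moreover obtain q r where "q * b + r * c = gcd b c"
    using bezout_int[of b c] by auto
  ultimately have bez: "p * a + (q' * q) * b + (q' * r) * c = 1"
    by algebra
  have rel: "a * x2 + b * x1 = 0" "b * x3 + c * x2 = 0" "c * x1 - a * x3 = 0"
    using linear_relations[OF assms] minor_signs(4) by auto
  \<comment> \<open>The Bezout identity turns into a linear functional with value 1 at
    \<open>(a, -b, c)\<close>; its value at a multiple of that vector is the multiplier.\<close>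
  define k where "k = p * x1 - q' * q * x2 + q' * r * x3"
  have "x1 = k * a" "x2 = - k * b" "x3 = k * c"
    unfolding k_def using bez rel by algebra+
  then show thesis by (rule that)
qed

text \<open>Let w be a Bezout vector with n . w = 1. Since n . x = 0, the triple product formula
  gives x = n \<times> (x \<times> w). Hence m . x = (m \<times> n) . (x \<times> w), an integer
  combination of the minors, each of which is a multiple of \<open>d\<close>.\<close>

lemma kernel_dvd:
  assumes "x1 * n1 + x2 * n2 + x3 * n3 = 0"
  shows "d dvd m1 * x1 + m2 * x2 + m3 * x3"
proof -
  obtain p q' where "p * n1 + q' * gcd n2 n3 = 1"
    using bezout_int[of n1 "gcd n2 n3"] n_coprime by auto
  moreover obtain q r where "q * n2 + r * n3 = gcd n2 n3"
    using bezout_int[of n2 n3] by auto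
  ultimately have bez: "p * n1 + (q' * q) * n2 + (q' * r) * n3 = 1"
    by algebra
  have "m1 * x1 + m2 * x2 + m3 * x3 =
      (m2 * n3 - m3 * n2) * (x2 * (q' * r) - x3 * (q' * q)) +
      (m1 * n3 - m3 * n1) * (x1 * (q' * r) - x3 * p) +
      (m1 * n2 - m2 * n1) * (x1 * (q' * q) - x2 * p)"
    using assms bez by algebra
  then show ?thesis
    unfolding minors by simp
qed

text \<open>The witness is the cross product n \<times> z with z =
  \<open>(p, - q' * q, q' * r)\<close>. It is orthogonal to n, and m . (n \<times> z) = z . (m
  \<times> n) is \<open>d\<close> times the Bezout combination of \<open>a\<close>,
  \<open>b\<close>, \<open>c\<close>, which is 1.\<close>

lemma kernel_step:
  obtains u1 u2 u3 where "u1 * n1 + u2 * n2 + u3 * n3 = 0" "m1 * u1 + m2 * u2 + m3 * u3 = d"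
proof -
  obtain p q' where "p * a + q' * gcd b c = 1"
    using bezout_int[of a "gcd b c"] minors_coprime by auto
  moreover obtain q r where "q * b + r * c = gcd b c"
    using bezout_int[of b c] by auto
  ultimately have bez: "p * a + (q' * q) * b + (q' * r) * c = 1"
    by algebra
  let ?u1 = "q' * q * n3 + q' * r * n2" and ?u2 = "p * n3 - q' * r * n1" and ?u3 = "- p * n2 - q' * q * n1"
  have "?u1 * n1 + ?u2 * n2 + ?u3 * n3 = 0" by algebra
  moreover have "m1 * ?u1 + m2 * ?u2 + m3 * ?u3 = d"
    using bez minors by algebra
  ultimately show thesis by (rule that)
qed

section \<open>Counting the factorizations of one length\<close>

text \<open>The base point y is any integer solution, possibly with negative coordinates. Two
  solutions differ by a multiple of \<open>(a, -b, c)\<close>, so the fiber is the nonnegative part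
  of one line.\<close>

lemma fiber_eq_image:
  assumes "y1 * n1 + y2 * n2 + y3 * n3 = n" "m1 * y1 + m2 * y2 + m3 * y3 = l"
  shows "fiber n l = (\<lambda>k. (y1 + k * a, y2 - k * b, y3 + k * c)) `
           {k. 0 \<le> y1 + k * a \<and> 0 \<le> y2 - k * b \<and> 0 \<le> y3 + k * c}"
    (is "_ = ?f ` ?K")
proof
  show "fiber n l \<subseteq> ?f ` ?K"
  proof
    fix x assume "x \<in> fiber n l"
    then obtain x1 x2 x3 where x: "x = (x1, x2, x3)" "0 \<le> x1" "0 \<le> x2" "0 \<le> x3"
      "x1 * n1 + x2 * n2 + x3 * n3 = n" "m1 * x1 + m2 * x2 + m3 * x3 = l"
      by (auto simp: fiber_def factorizations_def weighted_length_def)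
    obtain k where "x1 - y1 = k * a" "x2 - y2 = - k * b" "x3 - y3 = k * c"
      by (rule kernel_multiple[of "x1 - y1" "x2 - y2" "x3 - y3"])
        (use x assms in \<open>auto simp: algebra_simps\<close>)
    then have "x1 = y1 + k * a" "x2 = y2 - k * b" "x3 = y3 + k * c"
      by auto
    then show "x \<in> ?f ` ?K"
      using x by auto
  qed
  show "?f ` ?K \<subseteq> fiber n l"
  proof safe
    fix k assume "0 \<le> y1 + k * a" "0 \<le> y2 - k * b" "0 \<le> y3 + k * c"
    moreover have "(y1 + k * a) * n1 + (y2 - k * b) * n2 + (y3 + k * c) * n3 = n"
      unfolding assms(1)[symmetric] using orthogonal_n by algebra
    moreover have "m1 * (y1 + k * a) + m2 * (y2 - k * b) + m3 * (y3 + k * c) = l"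
      unfolding assms(2)[symmetric] using orthogonal_m by algebra
    ultimately show "?f k \<in> fiber n l"
      by (auto simp: fiber_def factorizations_def weighted_length_def)
  qed
qed

text \<open>Along the line the second coordinate bounds \<open>k\<close> from above, the first and
  the third from below. The side of the peak decides which lower bound is binding; the distance
  between the binding bounds is then \<open>n / b\<close> times the affine branch of the tent, and
  \<open>card_integers_between\<close> applies.\<close>

lemma card_fiber:
  assumes y: "y1 * n1 + y2 * n2 + y3 * n3 = n" "m1 * y1 + m2 * y2 + m3 * y3 = l" and n: "0 < n"
  shows "\<bar>real (card (fiber n l)) - of_int n / of_int b * tent (of_int l / of_int n)\<bar> \<le> 1"
proof -
  define K where "K = {k. 0 \<le> y1 + k * a \<and> 0 \<le> y2 - k * b \<and> 0 \<le> y3 + k * c}"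
  have card: "card (fiber n l) = card K"
    unfolding fiber_eq_image[OF y] K_def
    by (rule card_image) (use minor_signs in \<open>auto intro!: inj_onI\<close>)
  note rel = linear_relations[OF y]
  have real_rel:
    "of_int d * (real_of_int a * of_int y2 + of_int b * of_int y1) = of_int n3 * of_int l - of_int m3 * of_int n"
    "of_int d * (real_of_int b * of_int y3 + of_int c * of_int y2) = of_int m1 * of_int n - of_int n1 * of_int l"
    using rel by (metis of_int_mult of_int_add of_int_diff)+
  have t_less: "of_int l / of_int n * real_of_int n2 < of_int m2 \<longleftrightarrow> n2 * l < m2 * n"
    and t_greater: "of_int m2 < of_int l / of_int n * real_of_int n2 \<longleftrightarrow> m2 * n < n2 * l"
  proof -
    have "of_int l / of_int n * real_of_int n2 < of_int m2 \<longleftrightarrow> real_of_int (n2 * l) < real_of_int (m2 * n)"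
      using n by (simp add: field_simps)
    then show "of_int l / of_int n * real_of_int n2 < of_int m2 \<longleftrightarrow> n2 * l < m2 * n"
      by (simp only: of_int_less_iff)
    have "of_int m2 < of_int l / of_int n * real_of_int n2 \<longleftrightarrow> real_of_int (m2 * n) < real_of_int (n2 * l)"
      using n by (simp add: field_simps)
    then show "of_int m2 < of_int l / of_int n * real_of_int n2 \<longleftrightarrow> m2 * n < n2 * l"
      by (simp only: of_int_less_iff)
  qed
  have lower: "0 \<le> y + k * q \<longleftrightarrow> - of_int y / of_int q \<le> real_of_int k" if "0 < q" for y k q :: int
  proof -
    have "- of_int y / of_int q \<le> real_of_int k \<longleftrightarrow> real_of_int (- y) \<le> real_of_int (k * q)"
      using that by (simp add: field_simps)
    then show ?thesis
      by (simp only: of_int_le_iff) linarith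
  qed
  have upper: "0 \<le> y2 - k * b \<longleftrightarrow> real_of_int k \<le> of_int y2 / of_int b" for k
  proof -
    have "real_of_int k \<le> of_int y2 / of_int b \<longleftrightarrow> real_of_int (k * b) \<le> real_of_int y2"
      using minor_signs by (simp add: field_simps)
    then show ?thesis
      by (simp only: of_int_le_iff) linarith
  qed
  have scale: "of_int n / of_int b * max 0 z = max 0 (of_int n / of_int b * z)" for z :: real
    using n minor_signs by (auto simp: max_def zero_le_mult_iff mult_le_0_iff zero_le_divide_iff divide_le_0_iff)
  have "0 < a \<or> 0 < c"
    using orthogonal_n minor_signs n_pos by (cases "a = 0 \<and> c = 0") auto
  \<comment> \<open>The peak itself belongs to \<open>left\<close> or \<open>right\<close>,
    whichever has a positive denominator. The other two cases lie strictly on the side where the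
    tent is degenerate.\<close>
  then consider (left) "n2 * l \<le> m2 * n" "0 < a" | (right) "m2 * n \<le> n2 * l" "0 < c"
    | (below) "n2 * l < m2 * n" "a = 0" | (above) "m2 * n < n2 * l" "c = 0"
    using minor_signs by linarith
  then show ?thesis
  proof cases
    case left
    \<comment> \<open>The quantity \<open>c * x1 - a * x3\<close> is constant along the line and
      nonpositive left of the peak, so \<open>0 \<le> x1\<close> forces
      \<open>0 \<le> x3\<close>.\<close>
    have "0 \<le> y3 + k * c" if "0 \<le> y1 + k * a" for k
    proof -
      have "d * (c * y1 - a * y3) \<le> 0" using rel(3) left(1) by simp
      then have "c * y1 - a * y3 \<le> 0" using minor_signs(4) by (simp add: mult_le_0_iff)
      moreover have "0 \<le> c * (y1 + k * a)" using that minor_signs by simp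
      moreover have "a * (y3 + k * c) = c * (y1 + k * a) - (c * y1 - a * y3)" by algebra
      ultimately have "0 \<le> a * (y3 + k * c)" by linarith
      then show ?thesis using left(2) by (simp add: zero_le_mult_iff)
    qed
    then have K: "K = {k. - of_int y1 / of_int a \<le> real_of_int k \<and> real_of_int k \<le> of_int y2 / of_int b}"
      unfolding K_def lower[OF left(2), symmetric] upper[symmetric] by auto
    have "of_int n / of_int b * ((of_int l / of_int n * of_int n3 - of_int m3) / (of_int d * of_int a))
        = (real_of_int n3 * of_int l - of_int m3 * of_int n) / (of_int d * of_int a * of_int b)"
      using n minor_signs left(2) by (simp add: field_simps)
    also have "\<dots> = of_int y2 / of_int b - (- of_int y1 / of_int a)"
      unfolding real_rel[symmetric] using minor_signs left(2) by (simp add: field_simps)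
    finally have len: "of_int n / of_int b * tent (of_int l / of_int n) =
        max 0 (of_int y2 / of_int b - (- of_int y1 / of_int a))"
      using tent_left[of "of_int l / of_int n"] t_greater left by (simp only: scale not_less[symmetric] simp_thms)
    show ?thesis
      unfolding card len K by (rule card_integers_between)
  next
    case right
    \<comment> \<open>Right of the peak the same constant is nonnegative, so now the third
      coordinate controls the first.\<close>
    have "0 \<le> y1 + k * a" if "0 \<le> y3 + k * c" for k
    proof -
      have "0 \<le> d * (c * y1 - a * y3)" using rel(3) right(1) by simp
      then have "0 \<le> c * y1 - a * y3" using minor_signs(4) by (simp add: zero_le_mult_iff)
      moreover have "0 \<le> a * (y3 + k * c)" using that minor_signs by simp
      moreover have "c * (y1 + k * a) = a * (y3 + k * c) + (c * y1 - a * y3)" by algebra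
      ultimately have "0 \<le> c * (y1 + k * a)" by linarith
      then show ?thesis using right(2) by (simp add: zero_le_mult_iff)
    qed
    then have K: "K = {k. - of_int y3 / of_int c \<le> real_of_int k \<and> real_of_int k \<le> of_int y2 / of_int b}"
      unfolding K_def lower[OF right(2), symmetric] upper[symmetric] by auto
    have "of_int n / of_int b * ((of_int m1 - of_int n1 * (of_int l / of_int n)) / (of_int d * of_int c))
        = (real_of_int m1 * of_int n - of_int n1 * of_int l) / (of_int d * of_int c * of_int b)"
      using n minor_signs right(2) by (simp add: field_simps)
    also have "\<dots> = of_int y2 / of_int b - (- of_int y3 / of_int c)"
      unfolding real_rel[symmetric] using minor_signs right(2) by (simp add: field_simps)
    finally have len: "of_int n / of_int b * tent (of_int l / of_int n) =
        max 0 (of_int y2 / of_int b - (- of_int y3 / of_int c))"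
      using tent_right[of "of_int l / of_int n"] t_less right by (simp only: scale not_less[symmetric] simp_thms)
    show ?thesis
      unfolding card len K by (rule card_integers_between)
  next
    case below
    \<comment> \<open>With \<open>a = 0\<close> the first coordinate is \<open>y1\<close> on the
      whole line. The vanishing minor \<open>m2 * n3 - m3 * n2\<close> shows that it is negative
      before the peak, so there is no factorization, in agreement with the value 0 of the
      tent.\<close>
    have "n2 * (d * (b * y1)) = n3 * (n2 * l - m2 * n)"
      using rel(1) minors(1) below(2) by algebra
    then have "n2 * (d * (b * y1)) < 0"
      using below(1) n_pos by (simp add: mult_less_0_iff)
    then have "y1 < 0"
      using n_pos minor_signs by (simp add: mult_less_0_iff)
    then have "K = {}"
      using below(2) by (auto simp: K_def)
    moreover have "tent (of_int l / of_int n) = 0"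
      using below(1) t_less unfolding tent_def by (simp add: below(2))
    ultimately show ?thesis
      by (simp add: card)
  next
    case above
    have "n2 * (d * (b * y3)) = n1 * (m2 * n - n2 * l)"
      using rel(2) minors(3) above(2) by algebra
    then have "n2 * (d * (b * y3)) < 0"
      using above(1) n_pos by (simp add: mult_less_0_iff)
    then have "y3 < 0"
      using n_pos minor_signs by (simp add: mult_less_0_iff)
    then have "K = {}"
      using above(2) by (auto simp: K_def)
    moreover have "\<not> of_int l / of_int n * real_of_int n2 < of_int m2"
        "of_int l / of_int n * real_of_int n2 \<noteq> of_int m2"
      using above(1) t_greater by linarith+
    then have "tent (of_int l / of_int n) = 0"
      unfolding tent_def by (simp add: above(2))
    ultimately show ?thesis
      by (simp add: card)
  qed
qed

section \<open>Summing over all lengths in an interval\<close>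

text \<open>The admissible lengths form one residue class modulo \<open>d\<close>, so at most
  \<open>(\<beta> - \<alpha>) * n / d + 1\<close> of them lie in the interval, each with error at
  most 1. The term \<open>3 * n / n2\<close> bounds the Riemann sum error, three times the peak of
  the summed function.\<close>

lemma card_factorizations_length_between:
  assumes ab: "\<alpha> \<le> \<beta>" and n: "0 < n"
  shows "\<bar>real (card {x \<in> factorizations n1 n2 n3 n.
             real_of_int (weighted_length m1 m2 m3 x) \<in> {\<alpha> * of_int n..\<beta> * of_int n}})
           - (of_int n)\<^sup>2 / (of_int d * of_int b) * integral {\<alpha>..\<beta>} tent\<bar>
         \<le> (\<beta> - \<alpha>) * of_int n / of_int d + 1 + 3 * of_int n / of_int n2"
    (is "\<bar>real (card ?T) - _\<bar> \<le> _")
proof -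
  \<comment> \<open>A Bezout vector scaled by \<open>n\<close> gives an integer point of the plane,
    whether or not \<open>n\<close> has a factorization.\<close>
  obtain p q' where "p * n1 + q' * gcd n2 n3 = 1"
    using bezout_int[of n1 "gcd n2 n3"] n_coprime by auto
  moreover obtain q r where "q * n2 + r * n3 = gcd n2 n3"
    using bezout_int[of n2 n3] by auto
  ultimately have y: "n * p * n1 + n * q' * q * n2 + n * q' * r * n3 = n"
    by algebra
  define y1 y2 y3 where "y1 = n * p" and "y2 = n * q' * q" and "y3 = n * q' * r"
  note y = y[folded y1_def y2_def y3_def]
  define l where "l = m1 * y1 + m2 * y2 + m3 * y3"
  obtain u1 u2 u3 where u: "u1 * n1 + u2 * n2 + u3 * n3 = 0" "m1 * u1 + m2 * u2 + m3 * u3 = d"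
    by (rule kernel_step)
  have pos: "0 < real_of_int n" "0 < real_of_int d" "0 < real_of_int b" "0 < real_of_int n2"
    using n minor_signs n_pos by auto
  define u where "u = (\<alpha> * of_int n - of_int l) / real_of_int d"
  define v where "v = (\<beta> * of_int n - of_int l) / real_of_int d"
  define J where "J = {\<lceil>u\<rceil>..\<lfloor>v\<rfloor>}"
  have uv: "u \<le> v"
    using ab pos by (simp add: u_def v_def divide_right_mono)
  have in_J: "j \<in> J \<longleftrightarrow> real_of_int (l + j * d) \<in> {\<alpha> * of_int n..\<beta> * of_int n}" for j
    using pos by (auto simp: J_def u_def v_def ceiling_le_iff le_floor_iff field_simps)
  have T: "?T = (\<Union>j\<in>J. fiber n (l + j * d))"
  proof
    show "?T \<subseteq> (\<Union>j\<in>J. fiber n (l + j * d))"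
    proof
      fix x assume "x \<in> ?T"
      moreover obtain x1 x2 x3 where x: "x = (x1, x2, x3)" by (cases x)
      ultimately have x_in: "x \<in> factorizations n1 n2 n3 n" "x1 * n1 + x2 * n2 + x3 * n3 = n"
        and bounds: "real_of_int (weighted_length m1 m2 m3 x) \<in> {\<alpha> * of_int n..\<beta> * of_int n}"
        by (auto simp: factorizations_def)
      have "d dvd m1 * (x1 - y1) + m2 * (x2 - y2) + m3 * (x3 - y3)"
        using x_in(2) y by (intro kernel_dvd) (simp add: algebra_simps)
      then obtain j where "m1 * (x1 - y1) + m2 * (x2 - y2) + m3 * (x3 - y3) = d * j" ..
      then have j: "weighted_length m1 m2 m3 x = l + j * d"
        by (simp add: x weighted_length_def l_def algebra_simps)
      then show "x \<in> (\<Union>j\<in>J. fiber n (l + j * d))"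
        using x_in(1) bounds by (auto simp: fiber_def in_J)
    qed
    show "(\<Union>j\<in>J. fiber n (l + j * d)) \<subseteq> ?T"
      by (auto simp: fiber_def in_J)
  qed
  have "card ?T = (\<Sum>j\<in>J. card (fiber n (l + j * d)))"
    unfolding T
  proof (rule card_UN_disjoint)
    show "\<forall>j\<in>J. finite (fiber n (l + j * d))"
      using finite_factorizations[OF n_pos] by (simp add: fiber_def)
    show "\<forall>i\<in>J. \<forall>j\<in>J. i \<noteq> j \<longrightarrow> fiber n (l + i * d) \<inter> fiber n (l + j * d) = {}"
      using minor_signs(4) by (auto simp: fiber_def)
  qed (simp add: J_def)
  then have card_T: "real (card ?T) = (\<Sum>j\<in>J. real (card (fiber n (l + j * d))))"
    by simp

  \<comment> \<open>The predicted size of the fiber over length \<open>l + x * d\<close>, extended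
    to real \<open>x\<close>. Adding \<open>j\<close> copies of the kernel step to y supplies the
    base point that \<open>card_fiber\<close> requires at each \<open>j\<close>.\<close>
  define f where "f x = of_int n / of_int b * tent ((of_int l + x * of_int d) / of_int n)" for x
  have fiber: "\<bar>real (card (fiber n (l + j * d))) - f (of_int j)\<bar> \<le> 1" for j
  proof -
    have "(y1 + j * u1) * n1 + (y2 + j * u2) * n2 + (y3 + j * u3) * n3 = n"
      using arg_cong[OF u(1), of "\<lambda>z. j * z"] y by (simp add: algebra_simps)
    moreover have "m1 * (y1 + j * u1) + m2 * (y2 + j * u2) + m3 * (y3 + j * u3) = l + j * d"
      using arg_cong[OF u(2), of "\<lambda>z. j * z"] by (simp add: l_def algebra_simps)
    ultimately show ?thesis
      unfolding f_def of_int_add[symmetric] of_int_mult[symmetric] using n by (rule card_fiber)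
  qed
  have "\<bar>real (card ?T) - (\<Sum>j\<in>J. f (of_int j))\<bar> \<le> (\<Sum>j\<in>J. 1)"
    unfolding card_T sum_subtractf[symmetric]
    by (rule order_trans[OF sum_abs]) (intro sum_mono fiber)
  also have "\<dots> = real (card J)" by simp
  also have "\<dots> \<le> v - u + 1"
    using uv unfolding J_def by (simp; linarith)
  finally have count: "\<bar>real (card ?T) - (\<Sum>j\<in>J. f (of_int j))\<bar> \<le> v - u + 1" .

  \<comment> \<open>The mode of \<open>f\<close>: the position at which
    \<open>(l + p * d) / n\<close> equals \<open>m2 / n2\<close>.\<close>
  define p where "p = (of_int m2 / of_int n2 * of_int n - of_int l) / real_of_int d"
  have nonneg: "0 \<le> f x" for x
    using pos by (simp add: f_def tent_nonneg)
  have mono: "mono_on {..p} f"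
    unfolding f_def using pos
    by (intro mono_onI mult_left_mono mono_onD[OF mono_on_tent])
       (auto simp: p_def field_simps)
  have anti: "antimono_on {p..} f"
    unfolding f_def using pos
    by (intro monotone_onI mult_left_mono monotone_onD[OF antimono_on_tent])
       (auto simp: p_def field_simps)
  have "(of_int l + p * of_int d) / of_int n = real_of_int m2 / of_int n2"
    using pos by (simp add: p_def)
  then have "f p = of_int n / of_int b * (1 / of_int n2)"
    by (simp add: f_def tent_peak)
  \<comment> \<open>Here \<open>b \<ge> 1\<close>, being a positive integer.\<close>
  also have "\<dots> \<le> of_int n / of_int n2"
    using pos minor_signs by (simp add: field_simps)
  finally have peak: "f p \<le> of_int n / of_int n2" .
  have riemann: "\<bar>(\<Sum>j\<in>J. f (of_int j)) - integral {u..v} f\<bar> \<le> 3 * f p"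
    unfolding J_def using uv mono anti nonneg by (rule sum_integers_integral_unimodal)

  \<comment> \<open>The substitution \<open>t = (l + x * d) / n\<close> maps \<open>{u..v}\<close>
    onto \<open>{\<alpha>..\<beta>}\<close> and contributes the factor \<open>n / d\<close>;
    together with \<open>n / b\<close> from \<open>f\<close> this is the main term.\<close>
  have "(tent has_integral integral {\<alpha>..\<beta>} tent) (cbox \<alpha> \<beta>)"
    using integrable_tent[OF ab] by (simp add: integrable_integral)
  from has_integral_affinity'[OF this, of "of_int d / of_int n" "of_int l / of_int n"]
  have "((\<lambda>x. tent (of_int d / of_int n * x + of_int l / of_int n)) has_integral
      integral {\<alpha>..\<beta>} tent / (of_int d / of_int n))
      {(\<alpha> - of_int l / of_int n) / (of_int d / of_int n)..(\<beta> - of_int l / of_int n) / (of_int d / of_int n)}"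
    using pos by (simp add: divide_inverse mult.commute)
  moreover have "(\<alpha> - of_int l / of_int n) / (of_int d / of_int n) = u"
    "(\<beta> - of_int l / of_int n) / (of_int d / of_int n) = v"
    using pos by (simp_all add: u_def v_def field_simps)
  moreover have "of_int d / of_int n * x + of_int l / of_int n = (of_int l + x * of_int d) / real_of_int n" for x
    using pos by (simp add: field_simps)
  ultimately have "((\<lambda>x. tent ((of_int l + x * of_int d) / real_of_int n)) has_integral
      integral {\<alpha>..\<beta>} tent / (of_int d / of_int n)) {u..v}"
    by simp
  from has_integral_mult_right[OF this, of "of_int n / of_int b"]
  have "integral {u..v} f = of_int n / of_int b * (integral {\<alpha>..\<beta>} tent / (of_int d / of_int n))"
    unfolding f_def by (rule integral_unique)
  also have "\<dots> = (of_int n)\<^sup>2 / (of_int d * of_int b) * integral {\<alpha>..\<beta>} tent"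
    using pos by (simp add: field_simps power2_eq_square)
  finally have int: "integral {u..v} f = (of_int n)\<^sup>2 / (of_int d * of_int b) * integral {\<alpha>..\<beta>} tent" .

  have "v - u = (\<beta> - \<alpha>) * of_int n / of_int d"
    by (simp add: u_def v_def algebra_simps flip: diff_divide_distrib)
  then show ?thesis
    using count riemann peak unfolding int by linarith
qed

section \<open>The density and the final estimate\<close>

text \<open>The density is a constant multiple of the tent away from \<open>m2 / n2\<close>. At that
  point they differ when \<open>c = 0\<close>, since the density is then already 0 while the tent
  has its peak; a single point does not affect the integral.\<close>

lemma integral_length_density:
  "integral {\<alpha>..\<beta>} (length_density n1 n2 n3 m1 m2 m3) =
     of_int (2 * n1 * n2 * n3) / (of_int d * of_int b) * integral {\<alpha>..\<beta>} tent"
proof -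
  have pos: "0 < real_of_int d" "0 < real_of_int b" "0 < real_of_int n1" "0 < real_of_int n2" "0 < real_of_int n3"
    "0 \<le> real_of_int a" "0 \<le> real_of_int c"
    using minor_signs n_pos by auto
  have "real_of_int m2 * of_int n3 \<ge> of_int m3 * of_int n2" "real_of_int m1 * of_int n2 \<ge> of_int m2 * of_int n1"
    using real_minors pos mult_nonneg_nonneg[of "real_of_int d" "of_int a"]
      mult_nonneg_nonneg[of "real_of_int d" "of_int c"] by linarith+
  then have order: "real_of_int m3 / of_int n3 \<le> of_int m2 / of_int n2" "real_of_int m2 / of_int n2 \<le> of_int m1 / of_int n1"
    using pos by (simp_all add: field_simps)
  have "length_density n1 n2 n3 m1 m2 m3 t = of_int (2 * n1 * n2 * n3) / (of_int d * of_int b) * tent t"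
    if t: "t \<noteq> of_int m2 / of_int n2" for t
  proof -
    have ne: "t * of_int n2 \<noteq> of_int m2"
      using t pos by (auto simp: field_simps)
    consider "t < of_int m3 / of_int n3" "t < of_int m2 / of_int n2"
      | "of_int m3 / of_int n3 \<le> t" "t < of_int m2 / of_int n2"
      | "of_int m2 / of_int n2 < t" "t < of_int m1 / of_int n1"
      | "of_int m2 / of_int n2 < t" "of_int m1 / of_int n1 \<le> t"
      using t order by linarith
    then have "tent t = (if t < of_int m3 / of_int n3 then 0
      else if t < of_int m2 / of_int n2
        then (t * of_int n3 - of_int m3) / (of_int d * of_int a)
      else if t < of_int m1 / of_int n1
        then (of_int m1 - of_int n1 * t) / (of_int d * of_int c)
      else 0)"
    proof cases
      case 1
      then have "t * of_int n2 < of_int m2" "t * of_int n3 - of_int m3 \<le> 0"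
        using pos by (simp_all add: field_simps)
      then have "tent t = 0"
        using pos by (simp add: tent_def max.absorb1 divide_nonpos_nonneg)
      then show ?thesis
        using 1 by simp
    next
      case 2
      then have "t * of_int n2 < of_int m2" "0 \<le> t * of_int n3 - of_int m3"
        using pos by (simp_all add: field_simps)
      then show ?thesis
        using 2 pos by (simp add: tent_def)
    next
      case 3
      then have "of_int m2 < t * of_int n2" "0 \<le> of_int m1 - of_int n1 * t"
        using pos by (simp_all add: field_simps)
      then show ?thesis
        using 3 order pos by (simp add: tent_def)
    next
      case 4
      then have "of_int m2 < t * of_int n2" "of_int m1 - of_int n1 * t \<le> 0"
        using pos by (simp_all add: field_simps)
      then have "tent t = 0"
        using pos by (simp add: tent_def max.absorb1 divide_nonpos_nonneg)
      then show ?thesis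
        using 4 order by simp
    qed
    then show ?thesis
      unfolding length_density_def minors by simp
  qed
  then have "integral {\<alpha>..\<beta>} (length_density n1 n2 n3 m1 m2 m3) =
      integral {\<alpha>..\<beta>} (\<lambda>t. of_int (2 * n1 * n2 * n3) / (of_int d * of_int b) * tent t)"
    by (intro integral_spike[of "{of_int m2 / of_int n2}"]) auto
  then show ?thesis by simp
qed

end

lemma mset_count_in_length_mset:
  assumes "0 < n1" "0 < n2" "0 < n3"
  shows "mset_count_in (length_mset n1 n2 n3 m1 m2 m3 n) I =
    card {x \<in> factorizations n1 n2 n3 n. real_of_int (weighted_length m1 m2 m3 x) \<in> I}"
  using finite_factorizations[OF assms]
  by (simp add: mset_count_in_def length_mset_def filter_mset_image_mset filter_mset_mset_set)

theorem theorem1: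
  fixes n1 n2 n3 m1 m2 m3 n d :: int and \<alpha> \<beta> :: real
  assumes "0 < n1" "0 < n2" "0 < n3"
    and "n1 \<noteq> n2" "n1 \<noteq> n3" "n2 \<noteq> n3"
    and "gcd n1 (gcd n2 n3) = 1"
    and "real_of_int m3 / real_of_int n3 \<le> real_of_int m2 / real_of_int n2"
    and "real_of_int m2 / real_of_int n2 \<le> real_of_int m1 / real_of_int n1"
    and "real_of_int m3 / real_of_int n3 < real_of_int m2 / real_of_int n2 \<or>
         real_of_int m2 / real_of_int n2 < real_of_int m1 / real_of_int n1"
    and "d = length_gcd n1 n2 n3 m1 m2 m3"
    and "\<alpha> < \<beta>" and "0 < n"
  shows "\<bar>real (mset_count_in (length_mset n1 n2 n3 m1 m2 m3 n)
                 {\<alpha> * real_of_int n .. \<beta> * real_of_int n}) /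
            ((real_of_int n)\<^sup>2 / real_of_int (2 * n1 * n2 * n3))
          - integral {\<alpha>..\<beta>} (length_density n1 n2 n3 m1 m2 m3)\<bar>
         \<le> real_of_int (2 * n1 * n2 * n3) / real_of_int n *
           (5 * real_of_int d / real_of_int n2 + 2 * real_of_int d / real_of_int n +
            (\<beta> - \<alpha> + 2 * real_of_int d / real_of_int n) *
              (1 + real_of_int d * real_of_int (max n1 n3)))"
proof -
  let ?A = "m2 * n3 - m3 * n2" and ?B = "m1 * n3 - m3 * n1" and ?C = "m1 * n2 - m2 * n1"
  have "real_of_int (m3 * n2) \<le> real_of_int (m2 * n3)" "real_of_int (m2 * n1) \<le> real_of_int (m1 * n2)"
    using assms(1-3,8,9) by (simp_all add: field_simps)
  then have A: "0 \<le> ?A" and C: "0 \<le> ?C"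
    by (simp_all only: of_int_le_iff)
  have "real_of_int m3 / real_of_int n3 < real_of_int m1 / real_of_int n1"
    using assms(8-10) by linarith
  then have "real_of_int (m3 * n1) < real_of_int (m1 * n3)"
    using assms(1-3) by (simp add: field_simps)
  then have B: "0 < ?B"
    by (simp only: of_int_less_iff)
  have d: "d = gcd ?A (gcd ?B ?C)"
    using assms(11) by (simp add: length_gcd_def)
  have d_pos: "0 < d"
    using B by (simp add: d)
  obtain a b c where abc: "?A = d * a" "?B = d * b" "?C = d * c"
    using gcd_dvd1[of ?A "gcd ?B ?C"] gcd_dvd2[of ?A "gcd ?B ?C"] unfolding d[symmetric]
    by (metis dvd_def gcd_dvd1 gcd_dvd2 dvd_trans)
  \<comment> \<open>Dividing the minors by their gcd leaves coprime quotients, as the locale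
    demands.\<close>
  have "d * gcd a (gcd b c) = d"
    using d d_pos unfolding abc by (simp flip: gcd_mult_distrib_int)
  then have coprime: "gcd a (gcd b c) = 1"
    using d_pos by simp
  interpret embedding n1 n2 n3 m1 m2 m3 a b c d
  proof
    show "0 \<le> a" "0 < b" "0 \<le> c"
      using A B C d_pos unfolding abc by (simp_all add: zero_le_mult_iff zero_less_mult_iff)
  qed (use assms abc coprime d_pos in auto)

  let ?N = "real (mset_count_in (length_mset n1 n2 n3 m1 m2 m3 n) {\<alpha> * real_of_int n .. \<beta> * real_of_int n})"
  let ?I = "integral {\<alpha>..\<beta>} tent"
  let ?P = "real_of_int (2 * n1 * n2 * n3)"
  define E where "E = ?N - (of_int n)\<^sup>2 / (of_int d * of_int b) * ?I"
  define w where "w = real_of_int (max n1 n3)"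
  have n: "0 < real_of_int n" and n2: "0 < real_of_int n2" and d1: "1 \<le> real_of_int d" and b: "0 < real_of_int b"
    and w: "0 \<le> w"
    using assms minor_signs by (auto simp: w_def)
  have P: "0 \<le> ?P" using n_pos by simp
  have "\<bar>E\<bar> \<le> (\<beta> - \<alpha>) * of_int n / of_int d + 1 + 3 * of_int n / of_int n2"
    unfolding E_def mset_count_in_length_mset[OF n_pos]
    using assms by (intro card_factorizations_length_between) auto
  \<comment> \<open>From \<open>d \<ge> 1\<close>: the division by \<open>d\<close> is dropped,
    \<open>1 \<le> 2 * d\<close> and \<open>3 \<le> 5 * d\<close>.\<close>
  also have "\<dots> \<le> (\<beta> - \<alpha>) * of_int n + 2 * of_int d + 5 * of_int d * of_int n / of_int n2"
  proof (intro add_mono)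
    have "(\<beta> - \<alpha>) * of_int n * 1 \<le> (\<beta> - \<alpha>) * of_int n * of_int d"
      using assms(12) n d1 by (intro mult_left_mono) auto
    then show "(\<beta> - \<alpha>) * of_int n / of_int d \<le> (\<beta> - \<alpha>) * of_int n"
      using d1 by (simp add: divide_le_eq)
    show "3 * of_int n / of_int n2 \<le> 5 * of_int d * of_int n / real_of_int n2"
      using n n2 d1 by (intro divide_right_mono mult_right_mono) auto
  qed (use d1 in simp)
  \<comment> \<open>The factor \<open>1 + d * w\<close> is at least 1 and the additional
    \<open>2 * d\<close> is positive; both bring the bound into the stated shape, up to the
    normalization.\<close>
  also have "\<dots> \<le> ((\<beta> - \<alpha>) * of_int n + 2 * of_int d) * (1 + of_int d * w) + 2 * of_int d
      + 5 * of_int d * of_int n / of_int n2"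
  proof -
    have "0 \<le> ((\<beta> - \<alpha>) * of_int n + 2 * of_int d) * (of_int d * w)"
      using assms(12) n d1 w by (intro mult_nonneg_nonneg add_nonneg_nonneg) auto
    then show ?thesis
      using d1 by (simp add: ring_distribs)
  qed
  also have "\<dots> = of_int n * (5 * of_int d / of_int n2 + 2 * of_int d / of_int n +
            (\<beta> - \<alpha> + 2 * of_int d / of_int n) * (1 + of_int d * w))"
    using n n2 by (simp add: field_simps)
  finally have E: "\<bar>E\<bar> \<le> \<dots>" .
  \<comment> \<open>The normalization multiplies the counting error \<open>E\<close> by
    \<open>2 * n1 * n2 * n3 / n^2\<close>; one factor \<open>n\<close> cancels against the bound on
    \<open>E\<close>.\<close>
  have "?N / ((of_int n)\<^sup>2 / ?P) - integral {\<alpha>..\<beta>} (length_density n1 n2 n3 m1 m2 m3) = ?P / (of_int n)\<^sup>2 * E"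
    unfolding integral_length_density E_def using n by (simp add: right_diff_distrib mult_ac)
  also have "\<bar>\<dots>\<bar> = ?P / (of_int n)\<^sup>2 * \<bar>E\<bar>"
    using P by (simp only: abs_mult abs_divide abs_of_nonneg zero_le_power2)
  also have "\<dots> \<le> ?P / (of_int n)\<^sup>2 * (of_int n * (5 * of_int d / of_int n2 + 2 * of_int d / of_int n +
            (\<beta> - \<alpha> + 2 * of_int d / of_int n) * (1 + of_int d * w)))"
    using E P by (intro mult_left_mono) auto
  also have "\<dots> = ?P / of_int n * (5 * of_int d / of_int n2 + 2 * of_int d / of_int n +
            (\<beta> - \<alpha> + 2 * of_int d / of_int n) * (1 + of_int d * w))"
    using n by (simp add: power2_eq_square)
  finally show ?thesis
    unfolding w_def .
qed

end
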